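(* Consider the one-stage game with $n\ge 2$ sources, slot lengths $\sigma_I,\sigma_S,\sigma_C$ and age vector $(\Delta_{1,t},\dots,\Delta_{n,t})$, and let $\mathcal P$ be the set of probability vectors $\mathbf p=(p_1,\dots,p_n,p_I,p_C)$ whose payoff vector is individually rational. (1) Suppose $\sigma_S\le\sigma_C$. If $n=2$, then every probability vector $\mathbf p$ with $p_C=0$ belongs to $\mathcal P$. If $n>2$, then every probability vector $\mathbf p$ belongs to $\mathcal P$. (2) Suppose $\sigma_S>\sigma_C$. Then the access-fair strategy $\mathbf p=(1/n,\dots,1/n,0,0)$ belongs to $\mathcal P$ if and only if $\Delta_{k,t}\ge n(\sigma_S-\sigma_C)$ for every source $k\in\{1,\dots,n\}$.
   Context: One-stage game. There are $n\ge2$ sources $\mathcal N=\{1,\dots,n\}$. Idle, successful-transmission and collision slots have real lengths $\sigma_I,\sigma_S,\sigma_C>0$, with $\sigma_I<\sigma_S$ and $\sigma_I<\sigma_C$. At the beginning of slot $t$ source $k$ has age $\Delta_{k,t}$, and it is assumed that $\Delta_{k,t}\ge\sigma_S$ for all $k$. Each source $k$ chooses an action $a_k\in\{\mathcal T,\mathcal I\}$ (transmit or idle). Given the action profile $a=(a_1,\dots,a_n)$, the next age of source $k$ is: $\Delta_{k,t+1}=\Delta_{k,t}+\sigma_I$ if no source transmits (event $I$); $\Delta_{k,t}+\sigma_C$ if at least two sources transmit (event $C$); $\Delta_{k,t}+\sigma_S$ if exactly one source transmits and it is not $k$ (event $S_{-k}$); $\sigma_S$ if $k$ is the only source that transmits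 (event $S_k$). The payoff of $k$ is $U_{k,t}(a)=-\Delta_{k,t+1}$. Minmax payoff (over pure actions): $v_{k,t}^*=\min_{a_{-k}\in\{\mathcal T,\mathcal I\}^{n-1}}\max_{a_k\in\{\mathcal T,\mathcal I\}}U_{k,t}(a_k,a_{-k})$. Correlated strategies: a probability vector is $\mathbf p=(p_1,\dots,p_n,p_I,p_C)$ with nonnegative entries summing to $1$, where $p_k$ is the probability of event $S_k$, $p_I$ that of event $I$ and $p_C$ that of event $C$. The resulting expected payoff of source $k$ is $$U_{k,t}(\mathbf p)=-\Big[p_k\sigma_S+\Big(\sum_{j\ne k}p_j\Big)(\Delta_{k,t}+\sigma_S)+p_I(\Delta_{k,t}+\sigma_I)+p_C(\Delta_{k,t}+\sigma_C)\Big].$$ The set of individually rational probability vectors is $\mathcal P=\{\mathbf p: U_{k,t}(\mathbf p)\ge v_{k,t}^*\ \text{for all } k\in\mathcal N\}$. *)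

theory Defs
  imports Complex_Main "HOL-Library.FuncSet"
begin

datatype action = Transmit | Idle

definition sources :: "nat \<Rightarrow> nat set" where
  "sources n = {1..n}"

definition transmitters :: "nat \<Rightarrow> (nat \<Rightarrow> action) \<Rightarrow> nat set" where
  "transmitters n a = {k \<in> sources n. a k = Transmit}"

text \<open>
  The parameters \<open>\<sigma>I\<close>, \<open>\<sigma>S\<close>, \<open>\<sigma>C\<close> are the lengths of an idle, a successful-transmission
  and a collision slot; \<open>\<Delta> k\<close> is the age of source \<open>k\<close> at the beginning of the slot.
\<close>

definition next_age ::
  "nat \<Rightarrow> real \<Rightarrow> real \<Rightarrow> real \<Rightarrow> (nat \<Rightarrow> real) \<Rightarrow> nat \<Rightarrow> (nat \<Rightarrow> action) \<Rightarrow> real" where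
  "next_age n \<sigma>I \<sigma>S \<sigma>C \<Delta> k a =
     (let A = transmitters n a in
      if A = {} then \<Delta> k + \<sigma>I
      else if card A \<ge> 2 then \<Delta> k + \<sigma>C
      else if A = {k} then \<sigma>S
      else \<Delta> k + \<sigma>S)"

definition payoff ::
  "nat \<Rightarrow> real \<Rightarrow> real \<Rightarrow> real \<Rightarrow> (nat \<Rightarrow> real) \<Rightarrow> nat \<Rightarrow> (nat \<Rightarrow> action) \<Rightarrow> real" where
  "payoff n \<sigma>I \<sigma>S \<sigma>C \<Delta> k a = - next_age n \<sigma>I \<sigma>S \<sigma>C \<Delta> k a"

text \<open>
  The variable \<open>b\<close> ranges over the action profiles of the opponents of \<open>k\<close>, which
  \<open>b(k := x)\<close> completes by the own action \<open>x\<close>. Both index sets are finite and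
  nonempty, so \<open>Min\<close> and \<open>Max\<close> are attained.
\<close>

definition minmax_payoff ::
  "nat \<Rightarrow> real \<Rightarrow> real \<Rightarrow> real \<Rightarrow> (nat \<Rightarrow> real) \<Rightarrow> nat \<Rightarrow> real" where
  "minmax_payoff n \<sigma>I \<sigma>S \<sigma>C \<Delta> k =
     (MIN b \<in> (sources n - {k}) \<rightarrow>\<^sub>E {Transmit, Idle}.
        MAX x \<in> {Transmit, Idle}. payoff n \<sigma>I \<sigma>S \<sigma>C \<Delta> k (b(k := x)))"

text \<open>
  \<open>p_succ p k\<close> is the probability that \<open>k\<close> is the only transmitter. Only its values at
  \<open>k \<in> sources n\<close> matter below.
\<close>

record prob_vec =
  p_succ :: "nat \<Rightarrow> real"
  p_idle :: real
  p_coll :: real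

definition is_prob_vec :: "nat \<Rightarrow> prob_vec \<Rightarrow> bool" where
  "is_prob_vec n p \<longleftrightarrow>
     (\<forall>k \<in> sources n. p_succ p k \<ge> 0) \<and> p_idle p \<ge> 0 \<and> p_coll p \<ge> 0 \<and>
     (\<Sum>k \<in> sources n. p_succ p k) + p_idle p + p_coll p = 1"

definition expected_payoff ::
  "nat \<Rightarrow> real \<Rightarrow> real \<Rightarrow> real \<Rightarrow> (nat \<Rightarrow> real) \<Rightarrow> nat \<Rightarrow> prob_vec \<Rightarrow> real" where
  "expected_payoff n \<sigma>I \<sigma>S \<sigma>C \<Delta> k p =
     - (p_succ p k * \<sigma>S
        + (\<Sum>j \<in> sources n - {k}. p_succ p j) * (\<Delta> k + \<sigma>S)
        + p_idle p * (\<Delta> k + \<sigma>I)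
        + p_coll p * (\<Delta> k + \<sigma>C))"

definition individually_rational ::
  "nat \<Rightarrow> real \<Rightarrow> real \<Rightarrow> real \<Rightarrow> (nat \<Rightarrow> real) \<Rightarrow> prob_vec set" where
  "individually_rational n \<sigma>I \<sigma>S \<sigma>C \<Delta> =
     {p. is_prob_vec n p \<and>
         (\<forall>k \<in> sources n.
            expected_payoff n \<sigma>I \<sigma>S \<sigma>C \<Delta> k p \<ge> minmax_payoff n \<sigma>I \<sigma>S \<sigma>C \<Delta> k)}"

definition access_fair :: "nat \<Rightarrow> prob_vec" where
  "access_fair n = \<lparr>p_succ = (\<lambda>k. 1 / real n), p_idle = 0, p_coll = 0\<rparr>"

end

theory Submission
  imports Defs
begin

text \<open>
  A source \<open>k\<close> whose opponents all transmit gets \<open>- (\<Delta> k + \<sigma>C)\<close>, except that for \<open>n = 2\<close> it can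
  secure \<open>- (\<Delta> k + \<sigma>S)\<close> by staying idle. This punishment bounds the minmax payoff from above.
  Conversely, transmitting guarantees \<open>- (\<Delta> k + \<sigma>C)\<close> against every opponent profile, so for
  \<open>\<sigma>S > \<sigma>C\<close> the minmax payoff is exactly \<open>- (\<Delta> k + \<sigma>C)\<close>. Under a probability vector,
  \<open>k\<close> loses \<open>\<Delta> k\<close> plus the mean slot length, minus \<open>\<Delta> k\<close> times its success probability,
  and the claims follow by comparing.
\<close>

lemma finite_sources [simp]: "finite (sources n)"
  by (simp add: sources_def)

lemma card_sources [simp]: "card (sources n) = n"
  by (simp add: sources_def)

lemma finite_transmitters [simp]: "finite (transmitters n a)"
  by (simp add: transmitters_def)

lemma transmitters_upd_Transmit:
  assumes "k \<in> sources n"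
  shows "transmitters n (b(k := Transmit)) = insert k (transmitters n b)"
  using assms by (auto simp: transmitters_def)

lemma finite_opponent_profiles: "finite ((sources n - {k}) \<rightarrow>\<^sub>E {Transmit, Idle})"
  by (simp add: finite_PiE)

text \<open>The opponents' minimum is at most its value at any single profile, so one punishment
  \<open>b\<close> suffices.\<close>

lemma minmax_payoff_le:
  assumes "b \<in> (sources n - {k}) \<rightarrow>\<^sub>E {Transmit, Idle}"
    and "\<And>x. payoff n \<sigma>I \<sigma>S \<sigma>C \<Delta> k (b(k := x)) \<le> v"
  shows "minmax_payoff n \<sigma>I \<sigma>S \<sigma>C \<Delta> k \<le> v"
proof -
  have "minmax_payoff n \<sigma>I \<sigma>S \<sigma>C \<Delta> k
      \<le> (MAX x \<in> {Transmit, Idle}. payoff n \<sigma>I \<sigma>S \<sigma>C \<Delta> k (b(k := x)))"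
    unfolding minmax_payoff_def
    by (intro Min_le finite_imageI finite_opponent_profiles imageI assms(1))
  also have "\<dots> \<le> v"
    using assms(2) by simp
  finally show ?thesis .
qed

text \<open>The action \<open>x\<close> is fixed before \<open>b\<close>, so it is a reply that
  secures \<open>v\<close> whatever the opponents do, and every inner maximum is at least its
  payoff.\<close>

lemma minmax_payoff_ge:
  assumes "\<And>b. v \<le> payoff n \<sigma>I \<sigma>S \<sigma>C \<Delta> k (b(k := x))"
  shows "v \<le> minmax_payoff n \<sigma>I \<sigma>S \<sigma>C \<Delta> k"
proof -
  let ?B = "(sources n - {k}) \<rightarrow>\<^sub>E {Transmit, Idle}"
  let ?M = "\<lambda>b. MAX x \<in> {Transmit, Idle}. payoff n \<sigma>I \<sigma>S \<sigma>C \<Delta> k (b(k := x))"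
  have "v \<le> ?M b" for b
    using assms[of b] by (cases x) (auto simp: le_max_iff_disj)
  moreover have "finite (?M ` ?B)"
    by (intro finite_imageI finite_opponent_profiles)
  moreover have "?M ` ?B \<noteq> {}"
    by (simp add: PiE_eq_empty_iff)
  ultimately show ?thesis
    unfolding minmax_payoff_def by (subst Min_ge_iff) blast+
qed

text \<open>A transmitting source meets either a collision, with equality, or its own success. The
  latter resets the age to \<open>\<sigma>S\<close>, which is at most \<open>\<Delta> k\<close> and
  hence at most \<open>\<Delta> k + \<sigma>C\<close>.\<close>

lemma payoff_Transmit_ge:
  assumes "k \<in> sources n" and "\<sigma>C \<ge> 0" and "\<sigma>S \<le> \<Delta> k"
  shows "- (\<Delta> k + \<sigma>C) \<le> payoff n \<sigma>I \<sigma>S \<sigma>C \<Delta> k (b(k := Transmit))"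
proof -
  let ?A = "insert k (transmitters n b)"
  have "?A = {k}" if "\<not> 2 \<le> card ?A"
  proof -
    have "card ?A > 0"
      by (simp add: card_gt_0_iff)
    with that have "card ?A = 1"
      by linarith
    then show ?thesis
      by (metis card_1_singletonE insertI1 singletonD)
  qed
  then show ?thesis
    using assms
    by (auto simp: payoff_def next_age_def Let_def transmitters_upd_Transmit)
qed

text \<open>If \<open>k\<close> idles, its \<open>n - 1\<close> opponents remain the transmitters: a
  lone one succeeds, while two or more collide without \<open>k\<close>. The restricted abstraction
  makes \<open>b\<close> extensional, as \<open>minmax_payoff\<close> demands.\<close>

lemma payoff_opponents_Transmit:
  fixes \<sigma>I \<sigma>S \<sigma>C :: real and \<Delta> :: "nat \<Rightarrow> real"
  assumes "n \<ge> 2" and "k \<in> sources n"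
  defines "b \<equiv> (\<lambda>j\<in>sources n - {k}. Transmit)"
  shows "payoff n \<sigma>I \<sigma>S \<sigma>C \<Delta> k (b(k := Transmit)) = - (\<Delta> k + \<sigma>C)"
    and "payoff n \<sigma>I \<sigma>S \<sigma>C \<Delta> k (b(k := Idle)) = - (\<Delta> k + (if n = 2 then \<sigma>S else \<sigma>C))"
proof -
  have "transmitters n (b(k := Transmit)) = sources n"
    by (auto simp: transmitters_def b_def)
  then show "payoff n \<sigma>I \<sigma>S \<sigma>C \<Delta> k (b(k := Transmit)) = - (\<Delta> k + \<sigma>C)"
    using assms(1,2) by (auto simp: payoff_def next_age_def Let_def)
  have A: "transmitters n (b(k := Idle)) = sources n - {k}"
    by (auto simp: transmitters_def b_def)
  have card: "card (sources n - {k}) = n - 1"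
    using assms(2) by simp
  then have "sources n - {k} \<noteq> {}"
    using assms(1) by (metis card.empty diff_is_0_eq not_numeral_le_zero numeral_2_eq_2
        not_less_eq_eq One_nat_def)
  moreover have "2 \<le> card (sources n - {k}) \<longleftrightarrow> n \<noteq> 2"
    using card assms(1) by linarith
  ultimately show "payoff n \<sigma>I \<sigma>S \<sigma>C \<Delta> k (b(k := Idle))
      = - (\<Delta> k + (if n = 2 then \<sigma>S else \<sigma>C))"
    unfolding payoff_def next_age_def Let_def A by auto
qed

text \<open>For \<open>n = 2\<close> the punished source still chooses between a collision and the
  opponent's success, hence the \<open>min\<close>; for larger \<open>n\<close> both actions end in
  a collision.\<close>

lemma minmax_payoff_le_punishment:
  assumes "n \<ge> 2" and "k \<in> sources n"
  shows "minmax_payoff n \<sigma>I \<sigma>S \<sigma>C \<Delta> k \<le> - (\<Delta> k + (if n = 2 then min \<sigma>S \<sigma>C else \<sigma>C))"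
proof (rule minmax_payoff_le)
  show "payoff n \<sigma>I \<sigma>S \<sigma>C \<Delta> k ((\<lambda>j\<in>sources n - {k}. Transmit)(k := x))
      \<le> - (\<Delta> k + (if n = 2 then min \<sigma>S \<sigma>C else \<sigma>C))" for x
    using payoff_opponents_Transmit[OF assms, of \<sigma>I \<sigma>S \<sigma>C \<Delta>] by (cases x) auto
qed auto

lemma minmax_payoff_short_collision:
  assumes "n \<ge> 2" and "k \<in> sources n" and "\<sigma>C \<ge> 0" and "\<sigma>S \<le> \<Delta> k" and "\<sigma>C \<le> \<sigma>S"
  shows "minmax_payoff n \<sigma>I \<sigma>S \<sigma>C \<Delta> k = - (\<Delta> k + \<sigma>C)"
proof (rule antisym)
  show "minmax_payoff n \<sigma>I \<sigma>S \<sigma>C \<Delta> k \<le> - (\<Delta> k + \<sigma>C)"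
    using minmax_payoff_le_punishment[OF assms(1,2), of \<sigma>I \<sigma>S \<sigma>C \<Delta>] assms(5)
    by (auto split: if_splits)
  show "- (\<Delta> k + \<sigma>C) \<le> minmax_payoff n \<sigma>I \<sigma>S \<sigma>C \<Delta> k"
    using assms(2-4) by (rule minmax_payoff_ge[OF payoff_Transmit_ge])
qed

text \<open>Normalisation turns the opponents' total success probability into a function of the
  entries for \<open>k\<close>, idle and collision. What remains is a mean slot length and the age
  reset, which has probability \<open>p_succ p k\<close>.\<close>

lemma expected_payoff_eq:
  assumes "is_prob_vec n p" and "k \<in> sources n"
  shows "expected_payoff n \<sigma>I \<sigma>S \<sigma>C \<Delta> k p
    = p_succ p k * \<Delta> k
      - (\<Delta> k + (1 - p_idle p - p_coll p) * \<sigma>S + p_idle p * \<sigma>I + p_coll p * \<sigma>C)"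
proof -
  have "(\<Sum>j \<in> sources n - {k}. p_succ p j) = 1 - p_idle p - p_coll p - p_succ p k"
    using assms by (simp add: is_prob_vec_def sum_diff1)
  then show ?thesis
    unfolding expected_payoff_def by (simp only:) (simp add: algebra_simps)
qed

text \<open>The mean slot length is at most \<open>m\<close>, and the possible age reset only helps.
  Weighting the collision bound by \<open>p_coll p\<close> covers both
  \<open>\<sigma>C \<le> m\<close> and the case where collisions have probability zero.\<close>

lemma expected_payoff_ge:
  assumes p: "is_prob_vec n p" and k: "k \<in> sources n" and "\<Delta> k \<ge> 0"
    and "\<sigma>I \<le> m" and "\<sigma>S \<le> m" and coll: "p_coll p * \<sigma>C \<le> p_coll p * m"
  shows "- (\<Delta> k + m) \<le> expected_payoff n \<sigma>I \<sigma>S \<sigma>C \<Delta> k p"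
proof -
  \<comment> \<open>The third quantity is the total success probability.\<close>
  have nonneg: "p_succ p k \<ge> 0" "p_idle p \<ge> 0" "1 - p_idle p - p_coll p \<ge> 0"
    using p k sum_nonneg[of "sources n" "p_succ p"] by (auto simp: is_prob_vec_def)
  have "(1 - p_idle p - p_coll p) * \<sigma>S \<le> (1 - p_idle p - p_coll p) * m"
    and "p_idle p * \<sigma>I \<le> p_idle p * m"
    using nonneg assms by (auto intro: mult_left_mono)
  then have "(1 - p_idle p - p_coll p) * \<sigma>S + p_idle p * \<sigma>I + p_coll p * \<sigma>C
      \<le> (1 - p_idle p - p_coll p) * m + p_idle p * m + p_coll p * m"
    using coll by linarith
  also have "\<dots> = m"
    by (simp add: algebra_simps)
  finally show ?thesis
    using nonneg(1) \<open>\<Delta> k \<ge> 0\<close> mult_nonneg_nonneg[of "p_succ p k" "\<Delta> k"]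
    unfolding expected_payoff_eq[OF p k] by linarith
qed

lemma is_prob_vec_access_fair: "n \<noteq> 0 \<Longrightarrow> is_prob_vec n (access_fair n)"
  by (simp add: is_prob_vec_def access_fair_def)

lemma expected_payoff_access_fair:
  assumes "k \<in> sources n"
  shows "expected_payoff n \<sigma>I \<sigma>S \<sigma>C \<Delta> k (access_fair n) = \<Delta> k / real n - (\<Delta> k + \<sigma>S)"
proof -
  have "n \<noteq> 0"
    using assms by (auto simp: sources_def)
  then show ?thesis
    by (subst expected_payoff_eq)
      (use assms in \<open>simp_all add: is_prob_vec_access_fair, simp add: access_fair_def\<close>)
qed

theorem lemma1:
  fixes n :: nat and \<sigma>I \<sigma>S \<sigma>C :: real and \<Delta> :: "nat \<Rightarrow> real"
  assumes "n \<ge> 2"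
    and "\<sigma>I > 0" and "\<sigma>S > 0" and "\<sigma>C > 0"
    and "\<sigma>I < \<sigma>S" and "\<sigma>I < \<sigma>C"
    and "\<forall>k \<in> sources n. \<Delta> k \<ge> \<sigma>S"
  shows "(\<sigma>S \<le> \<sigma>C \<longrightarrow>
            (n = 2 \<longrightarrow> (\<forall>p. is_prob_vec n p \<and> p_coll p = 0
                              \<longrightarrow> p \<in> individually_rational n \<sigma>I \<sigma>S \<sigma>C \<Delta>)) \<and>
            (n > 2 \<longrightarrow> (\<forall>p. is_prob_vec n p
                              \<longrightarrow> p \<in> individually_rational n \<sigma>I \<sigma>S \<sigma>C \<Delta>))) \<and>
         (\<sigma>S > \<sigma>C \<longrightarrow>
            (access_fair n \<in> individually_rational n \<sigma>I \<sigma>S \<sigma>C \<Delta> \<longleftrightarrow>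
             (\<forall>k \<in> sources n. \<Delta> k \<ge> real n * (\<sigma>S - \<sigma>C))))"
proof (intro conjI impI allI)
  fix p
  assume "\<sigma>S \<le> \<sigma>C" and "n = 2" and p: "is_prob_vec n p \<and> p_coll p = 0"
  have "minmax_payoff n \<sigma>I \<sigma>S \<sigma>C \<Delta> k \<le> expected_payoff n \<sigma>I \<sigma>S \<sigma>C \<Delta> k p"
    if k: "k \<in> sources n" for k
  proof (rule order_trans)
    show "minmax_payoff n \<sigma>I \<sigma>S \<sigma>C \<Delta> k \<le> - (\<Delta> k + \<sigma>S)"
      using minmax_payoff_le_punishment[OF assms(1) k, of \<sigma>I \<sigma>S \<sigma>C \<Delta>] \<open>\<sigma>S \<le> \<sigma>C\<close> \<open>n = 2\<close>
      by (simp add: min_absorb1)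
    \<comment> \<open>Here \<open>m\<close> is \<open>\<sigma>S\<close>; the collision condition
      reads \<open>0 \<le> 0\<close>.\<close>
    show "- (\<Delta> k + \<sigma>S) \<le> expected_payoff n \<sigma>I \<sigma>S \<sigma>C \<Delta> k p"
      using p k assms by (intro expected_payoff_ge) force+
  qed
  then show "p \<in> individually_rational n \<sigma>I \<sigma>S \<sigma>C \<Delta>"
    using p by (simp add: individually_rational_def)
next
  fix p
  assume "\<sigma>S \<le> \<sigma>C" and "n > 2" and p: "is_prob_vec n p"
  have "minmax_payoff n \<sigma>I \<sigma>S \<sigma>C \<Delta> k \<le> expected_payoff n \<sigma>I \<sigma>S \<sigma>C \<Delta> k p"
    if k: "k \<in> sources n" for k
  proof (rule order_trans)
    show "minmax_payoff n \<sigma>I \<sigma>S \<sigma>C \<Delta> k \<le> - (\<Delta> k + \<sigma>C)"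
      using minmax_payoff_le_punishment[OF assms(1) k, of \<sigma>I \<sigma>S \<sigma>C \<Delta>] \<open>n > 2\<close> by simp
    \<comment> \<open>Here \<open>m\<close> is \<open>\<sigma>C\<close>, the longest slot.\<close>
    show "- (\<Delta> k + \<sigma>C) \<le> expected_payoff n \<sigma>I \<sigma>S \<sigma>C \<Delta> k p"
      using p k \<open>\<sigma>S \<le> \<sigma>C\<close> assms by (intro expected_payoff_ge) force+
  qed
  then show "p \<in> individually_rational n \<sigma>I \<sigma>S \<sigma>C \<Delta>"
    using p by (simp add: individually_rational_def)
next
  assume "\<sigma>S > \<sigma>C"
  have "minmax_payoff n \<sigma>I \<sigma>S \<sigma>C \<Delta> k \<le> expected_payoff n \<sigma>I \<sigma>S \<sigma>C \<Delta> k (access_fair n)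
      \<longleftrightarrow> real n * (\<sigma>S - \<sigma>C) \<le> \<Delta> k" if k: "k \<in> sources n" for k
  proof -
    have "minmax_payoff n \<sigma>I \<sigma>S \<sigma>C \<Delta> k = - (\<Delta> k + \<sigma>C)"
      using k assms \<open>\<sigma>S > \<sigma>C\<close> by (intro minmax_payoff_short_collision) auto
    \<comment> \<open>The current age cancels: the mean gain \<open>\<Delta> k / real n\<close> from
      a reset must cover the excess of a success slot over a collision slot.\<close>
    then have "minmax_payoff n \<sigma>I \<sigma>S \<sigma>C \<Delta> k \<le> expected_payoff n \<sigma>I \<sigma>S \<sigma>C \<Delta> k (access_fair n)
        \<longleftrightarrow> \<sigma>S - \<sigma>C \<le> \<Delta> k / real n"
      unfolding expected_payoff_access_fair[OF k] by linarith
    also have "\<dots> \<longleftrightarrow> real n * (\<sigma>S - \<sigma>C) \<le> \<Delta> k"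
      using assms(1) by (simp add: pos_le_divide_eq mult.commute)
    finally show ?thesis .
  qed
  then show "access_fair n \<in> individually_rational n \<sigma>I \<sigma>S \<sigma>C \<Delta>
      \<longleftrightarrow> (\<forall>k \<in> sources n. \<Delta> k \<ge> real n * (\<sigma>S - \<sigma>C))"
    using assms(1) by (simp add: individually_rational_def is_prob_vec_access_fair)
qed

end
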